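(* For every fixed real number $\kappa>0$ there exists a constant $C_\kappa>0$, depending only on $\kappa$, such that for all integers $K\ge 2$, $$\frac{1}{K(K-1)}\sum_{\substack{1\le a,b\le K\\ a\ne b}}\ \prod_{p\mid a^a-b^b}\left(1+\frac{\kappa}{p}\right)\ \le\ C_\kappa .$$
   Context: The sum is over ordered pairs $(a,b)$ of distinct integers in $[1,K]$. The product is over the distinct primes $p$ dividing the nonzero integer $a^a-b^b$; an empty product equals $1$. *)

theory Defs
  imports Complex_Main "HOL-Computational_Algebra.Primes"
begin

end

theory Submission
  imports Defs "HOL-Number_Theory.Number_Theory" "HOL-Analysis.Summation_Tests"
begin

text \<open>
  Split the primes dividing \<open>N = a^a - b^b\<close> at \<open>\<surd>K\<close> and \<open>K\<close>.
  At most \<open>K\<close> primes above \<open>K\<close> divide \<open>N\<close>, because \<open>\<bar>N\<bar> \<le> K^K\<close>, so they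
  contribute at most \<open>exp \<kappa>\<close>.  All primes in \<open>(\<surd>K, K]\<close> together contribute a bounded factor,
  by Chebyshev's bound on dyadic blocks.  For the primes up to \<open>\<surd>K\<close> expand the product according
  to its largest prime \<open>p\<close>; bounding the rest by \<open>\<Prod>q<p. 1 + \<kappa> / q = O(p^(1/6))\<close>, it
  suffices that \<open>p\<close> divides \<open>N\<close> for a proportion \<open>O(p^(-1/3))\<close> of the pairs.
  To see this, write \<open>a = u + p k\<close> with \<open>u < p\<close>: then \<open>a^a \<equiv> u^(u + k) (mod p)\<close>, so for
  fixed \<open>b\<close> and \<open>u\<close> the number \<open>k\<close> is restricted to one residue class modulo the order of
  \<open>u\<close>, while at most \<open>T^2\<close> nonzero residues have order at most \<open>T = p^(1/3)\<close>.
\<close>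

section \<open>Chebyshev bounds for primes in dyadic blocks\<close>

lemma prod_primes_dvd:
  fixes N :: nat
  assumes "finite P" and "\<And>p. p \<in> P \<Longrightarrow> prime p" and "\<And>p. p \<in> P \<Longrightarrow> p dvd N"
  shows "\<Prod>P dvd N"
  using assms
proof (induction P rule: finite_induct)
  case (insert p P)
  have "coprime p (\<Prod>P)"
    using insert by (intro prod_coprime_right) (auto intro!: primes_coprime)
  then show ?case
    using insert by (simp add: divides_mult)
qed auto

text \<open>Distinct primes dividing \<open>N\<close> have their product dividing \<open>N\<close>,
  and each factor is at least \<open>m\<close>. This serves both for central binomial coefficients
  and for the prime divisors of \<open>N\<close> above \<open>K\<close>.\<close>

lemma power_card_primes_le:
  fixes N m :: nat
  assumes "finite P" "N > 0" and "\<And>p. p \<in> P \<Longrightarrow> prime p" "\<And>p. p \<in> P \<Longrightarrow> p dvd N"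
    and "\<And>p. p \<in> P \<Longrightarrow> m \<le> p"
  shows "m ^ card P \<le> N"
proof -
  have "m ^ card P = (\<Prod>p\<in>P. m)" by simp
  also have "\<dots> \<le> \<Prod>P" by (rule prod_mono) (use assms in auto)
  also have "\<dots> \<le> N" using prod_primes_dvd[of P N] assms by (auto intro: dvd_imp_le)
  finally show ?thesis .
qed

text \<open>Chebyshev's argument with \<open>n = 2 ^ j\<close>: a prime in \<open>(n, 2n]\<close>
  divides \<open>(2n)!\<close> but not \<open>n!\<close>, hence divides the central binomial
  coefficient, which is at most \<open>2 ^ (2 * n)\<close>. Comparing exponents of 2 gives the
  bound.\<close>

lemma card_primes_dyadic:
  "j * card {p::nat. prime p \<and> 2 ^ j < p \<and> p \<le> 2 ^ Suc j} \<le> 2 ^ Suc j"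
proof -
  define n :: nat where "n = 2 ^ j"
  define P where "P = {p::nat. prime p \<and> 2 ^ j < p \<and> p \<le> 2 ^ Suc j}"
  have fin: "finite P" by (rule finite_subset[of _ "{..2 ^ Suc j}"]) (auto simp: P_def)
  have dvd: "p dvd (2 * n choose n)" if "p \<in> P" for p
  proof -
    from that have p: "prime p" "n < p" "p \<le> 2 * n" by (auto simp: P_def n_def)
    have "p dvd fact n * fact n * (2 * n choose n)"
      using binomial_fact_lemma[of n "2 * n"] p by (simp add: mult_2 prime_dvd_fact_iff)
    then show ?thesis using p by (simp add: prime_dvd_mult_iff prime_dvd_fact_iff)
  qed
  have "n ^ card P \<le> (2 * n choose n)"
    by (rule power_card_primes_le) (use fin dvd in \<open>auto simp: P_def n_def\<close>)
  also have "\<dots> \<le> 2 ^ (2 * n)" by (rule binomial_le_pow2)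
  finally have "(2::nat) ^ (j * card P) \<le> 2 ^ (2 * n)" by (simp add: n_def power_mult)
  then show ?thesis by (simp add: n_def P_def)
qed

text \<open>Each summand is at most \<open>1 / 2 ^ j\<close>. Adding the trivial count
  \<open>card P \<le> 2 ^ j\<close> to the Chebyshev bound on \<open>j * card P\<close> turns the
  factor \<open>j\<close> into \<open>j + 1\<close>, so the estimate also makes sense for
  \<open>j = 0\<close>.\<close>

lemma sum_inverse_primes_dyadic:
  "(\<Sum>p | prime p \<and> 2 ^ j < p \<and> p \<le> 2 ^ Suc j. 1 / real p) \<le> 4 / (real j + 1)"
proof -
  define P where "P = {p::nat. prime p \<and> 2 ^ j < p \<and> p \<le> 2 ^ Suc j}"
  have "card P \<le> card {2 ^ j<..(2::nat) ^ Suc j}"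
    by (rule card_mono) (auto simp: P_def)
  then have c: "card P \<le> 2 ^ j" by simp
  have "real (j * card P) \<le> real (2 ^ Suc j)"
    unfolding P_def of_nat_le_iff by (rule card_primes_dyadic)
  moreover have "real (card P) \<le> 2 ^ j" using c by (metis of_nat_le_iff of_nat_numeral of_nat_power)
  moreover have "(0::real) \<le> 2 ^ j" by simp
  ultimately have "(real j + 1) * real (card P) \<le> 4 * 2 ^ j"
    unfolding distrib_right of_nat_mult of_nat_power power_Suc of_nat_numeral by linarith
  then have card: "real (card P) / 2 ^ j \<le> 4 / (real j + 1)"
    by (simp add: field_simps)
  have "(\<Sum>p\<in>P. 1 / real p) \<le> (\<Sum>p\<in>P. 1 / 2 ^ j)"
  proof (intro sum_mono divide_left_mono)
    fix p assume "p \<in> P"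
    then have "2 ^ j < p" by (simp add: P_def)
    then have "real (2 ^ j) \<le> real p" unfolding of_nat_le_iff by (rule less_imp_le)
    then show le: "2 ^ j \<le> real p" by simp
    have "(0::real) < 2 ^ j" by simp
    with le show "0 < real p * 2 ^ j" by (intro mult_pos_pos) linarith+
  qed simp
  also have "\<dots> \<le> 4 / (real j + 1)" using card by simp
  finally show ?thesis by (simp add: P_def)
qed

lemma sum_inverse_primes_le:
  assumes "m \<le> n"
  shows "(\<Sum>p | prime p \<and> 2 ^ m < p \<and> p \<le> 2 ^ n. 1 / real p) \<le> (\<Sum>j=m..<n. 4 / (real j + 1))"
  using assms
proof (induction n rule: dec_induct)
  case base
  have "{p::nat. prime p \<and> 2 ^ m < p \<and> p \<le> 2 ^ m} = {}" by auto
  then show ?case by (simp only: sum.empty) simp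
next
  case (step n)
  have le: "(2::nat) ^ m \<le> 2 ^ n" using step by simp
  have "{p::nat. prime p \<and> 2 ^ m < p \<and> p \<le> 2 ^ Suc n} =
      {p. prime p \<and> 2 ^ m < p \<and> p \<le> 2 ^ n} \<union> {p. prime p \<and> 2 ^ n < p \<and> p \<le> 2 ^ Suc n}"
    using le by (auto intro: le_less_trans[OF le])
  moreover have "finite {p::nat. prime p \<and> 2 ^ m < p \<and> p \<le> 2 ^ n}"
    by (rule finite_subset[of _ "{..2 ^ n}"]) auto
  moreover have "finite {p::nat. prime p \<and> 2 ^ n < p \<and> p \<le> 2 ^ Suc n}"
    by (rule finite_subset[of _ "{..2 ^ Suc n}"]) auto
  ultimately have "(\<Sum>p | prime p \<and> 2 ^ m < p \<and> p \<le> 2 ^ Suc n. 1 / real p) =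
     (\<Sum>p | prime p \<and> 2 ^ m < p \<and> p \<le> 2 ^ n. 1 / real p) +
     (\<Sum>p | prime p \<and> 2 ^ n < p \<and> p \<le> 2 ^ Suc n. 1 / real p)"
    by (simp only:) (rule sum.union_disjoint, auto)
  then show ?case
    using step sum_inverse_primes_dyadic[of n] by simp
qed

lemma sum_inverse_primes_sqrt_le:
  assumes "K \<ge> 1"
  shows "(\<Sum>p | prime p \<and> K < p\<^sup>2 \<and> p \<le> K. 1 / real p) \<le> 8"
proof -
  obtain J where J: "2 ^ J \<le> K" "K < 2 ^ Suc J"
    using ex_power_ivl1[of 2 K] assms by auto
  define m where "m = J div 2"
  have m: "2 * m \<le> J" "J \<le> 2 * m + 1" by (auto simp: m_def)
  have sub: "{p::nat. prime p \<and> K < p\<^sup>2 \<and> p \<le> K} \<subseteq> {p. prime p \<and> 2 ^ m < p \<and> p \<le> 2 ^ Suc J}"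
  proof safe
    fix p :: nat assume p: "prime p" "K < p\<^sup>2" "p \<le> K"
    have "(2 ^ m)\<^sup>2 = (2::nat) ^ (2 * m)" by (simp add: power_mult [symmetric] mult.commute)
    also have "\<dots> \<le> 2 ^ J" using m by (intro power_increasing) auto
    also have "\<dots> < p\<^sup>2" using J p by linarith
    finally show "2 ^ m < p" by (rule power_less_imp_less_base) auto
    show "p \<le> 2 ^ Suc J" using J p by linarith
  qed
  have "(\<Sum>p | prime p \<and> K < p\<^sup>2 \<and> p \<le> K. 1 / real p) \<le>
      (\<Sum>p | prime p \<and> 2 ^ m < p \<and> p \<le> 2 ^ Suc J. 1 / real p)"
    by (rule sum_mono2[OF _ sub]) (auto intro: finite_subset[of _ "{..2 ^ Suc J}"])
  also have "\<dots> \<le> (\<Sum>j=m..<Suc J. 4 / (real j + 1))"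
    by (rule sum_inverse_primes_le) (use m in auto)
  also have "\<dots> \<le> (\<Sum>j=m..<Suc J. 4 / (real m + 1))"
    by (intro sum_mono divide_left_mono) auto
  also have "\<dots> = real (Suc J - m) * 4 / (real m + 1)" by simp
  \<comment> \<open>Since \<open>J \<le> 2 * m + 1\<close>, the number of blocks is at most
    \<open>m + 2 \<le> 2 * (m + 1)\<close>.\<close>
  also have "\<dots> \<le> 8"
    using m by (simp add: field_simps of_nat_diff)
  finally show ?thesis .
qed

section \<open>Growth of products over small primes\<close>

lemma prod_one_plus_le_exp:
  fixes f :: "'a \<Rightarrow> real"
  assumes "\<And>x. x \<in> A \<Longrightarrow> 0 \<le> f x"
  shows "(\<Prod>x\<in>A. 1 + f x) \<le> exp (\<Sum>x\<in>A. f x)"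
proof (cases "finite A")
  case True
  have "(\<Prod>x\<in>A. 1 + f x) \<le> (\<Prod>x\<in>A. exp (f x))"
    by (rule prod_mono) (use assms in \<open>auto simp: add_nonneg_nonneg\<close>)
  then show ?thesis using True by (simp add: exp_sum)
qed auto

text \<open>The terms tend to 0: those with index at least \<open>M > 4 / \<epsilon>\<close> are
  below \<epsilon>, and the first \<open>M\<close> terms cost at most 4 each. An arbitrarily small
  slope is what makes the exponent of the next product independent of \<kappa>.\<close>

lemma harmonic_le_linear:
  fixes \<epsilon> :: real
  assumes "\<epsilon> > 0"
  shows "\<exists>C\<ge>0. \<forall>J. (\<Sum>j<J. 4 / (real j + 1)) \<le> C + \<epsilon> * real J"
proof -
  obtain M :: nat where M: "4 / \<epsilon> < real M" using reals_Archimedean2 by blast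
  have "(\<Sum>j<J. 4 / (real j + 1)) \<le> 4 * real (min J M) + \<epsilon> * real J" for J
  proof (induction J)
    case (Suc J)
    have "4 / (real J + 1) \<le> 4 * (real (min (Suc J) M) - real (min J M)) + \<epsilon>"
    proof (cases "J < M")
      case True
      then have "4 * (real (min (Suc J) M) - real (min J M)) = 4" by (simp add: min_def)
      moreover have "4 / (real J + 1) \<le> 4" by (simp add: field_simps)
      ultimately show ?thesis using assms by linarith
    next
      case False
      then have "4 / \<epsilon> < real J + 1" using M by linarith
      then show ?thesis using False assms by (simp add: field_simps)
    qed
    with Suc show ?case by (simp add: algebra_simps)
  qed simp
  moreover have "4 * real (min J M) \<le> 4 * real M" for J by simp
  ultimately show ?thesis
    by (intro exI[of _ "4 * real M"]) (smt (verit) of_nat_0_le_iff)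
qed

text \<open>Any fixed exponent below \<open>1/3\<close> would serve, since it has to be beaten by
  the saving \<open>p powr (-1/3)\<close> in the count of pairs; with \<open>1/6\<close> the final
  series has exponent \<open>-1 + 1/6 - 1/3 = -7/6\<close>.\<close>

lemma prod_primes_below_le_powr:
  fixes \<kappa> :: real
  assumes "\<kappa> > 0"
  shows "\<exists>A>0. \<forall>n\<ge>1. (\<Prod>q | prime q \<and> q < n. 1 + \<kappa> / real q) \<le> A * real n powr (1/6)"
proof -
  \<comment> \<open>Chosen so that \<open>\<kappa> * \<epsilon> * J = J * ln 2 / 6\<close>, which is
    at most \<open>ln n / 6\<close> when \<open>2 ^ J \<le> n\<close>.\<close>
  define \<epsilon> where "\<epsilon> = ln 2 / (6 * \<kappa>)"
  have eps: "\<epsilon> > 0" using assms by (simp add: \<epsilon>_def)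
  obtain C where C: "C \<ge> 0" "\<And>J. (\<Sum>j<J. 4 / (real j + 1)) \<le> C + \<epsilon> * real J"
    using harmonic_le_linear[OF eps] by blast
  have "(\<Prod>q | prime q \<and> q < n. 1 + \<kappa> / real q) \<le> exp (\<kappa> * (C + \<epsilon>)) * real n powr (1/6)"
    if n: "n \<ge> 1" for n
  proof -
    obtain J where J: "2 ^ J \<le> n" "n < 2 ^ Suc J"
      using ex_power_ivl1[of 2 n] n by auto
    have "(\<Sum>q | prime q \<and> q < n. 1 / real q) \<le>
        (\<Sum>q | prime q \<and> 2 ^ 0 < q \<and> q \<le> 2 ^ Suc J. 1 / real q)"
    proof (rule sum_mono2)
      show "finite {q::nat. prime q \<and> 2 ^ 0 < q \<and> q \<le> 2 ^ Suc J}"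
        by (rule finite_subset[of _ "{..2 ^ Suc J}"]) auto
      show "{q. prime q \<and> q < n} \<subseteq> {q. prime q \<and> 2 ^ 0 < q \<and> q \<le> 2 ^ Suc J}"
        using J by (auto dest: prime_gt_1_nat)
    qed auto
    also have "\<dots> \<le> (\<Sum>j=0..<Suc J. 4 / (real j + 1))"
      by (rule sum_inverse_primes_le) simp
    also have "\<dots> \<le> C + \<epsilon> * real (Suc J)"
      using C(2)[of "Suc J"] by (simp only: atLeast0LessThan)
    finally have S: "(\<Sum>q | prime q \<and> q < n. 1 / real q) \<le> C + \<epsilon> + \<epsilon> * real J"
      by (simp add: algebra_simps)
    have "real J * ln 2 = ln (2 ^ J)" by (simp add: ln_realpow)
    also have "\<dots> \<le> ln (real n)"
    proof -
      have "real (2 ^ J) \<le> real n" using J(1) of_nat_le_iff by blast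
      then show ?thesis using n by simp
    qed
    finally have L: "\<kappa> * (\<epsilon> * real J) \<le> ln (real n) / 6"
      using assms by (simp add: \<epsilon>_def field_simps)
    have "(\<Prod>q | prime q \<and> q < n. 1 + \<kappa> / real q) \<le> exp (\<Sum>q | prime q \<and> q < n. \<kappa> / real q)"
      by (rule prod_one_plus_le_exp) (use assms in auto)
    also have "(\<Sum>q | prime q \<and> q < n. \<kappa> / real q) = \<kappa> * (\<Sum>q | prime q \<and> q < n. 1 / real q)"
      by (simp add: sum_distrib_left)
    also have "exp \<dots> \<le> exp (\<kappa> * (C + \<epsilon>) + ln (real n) / 6)"
      using mult_left_mono[OF S, of \<kappa>] assms L by (simp add: algebra_simps)
    also have "\<dots> = exp (\<kappa> * (C + \<epsilon>)) * real n powr (1/6)"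
      using n by (simp add: exp_add powr_def)
    finally show ?thesis .
  qed
  then show ?thesis by (intro exI[of _ "exp (\<kappa> * (C + \<epsilon>))"]) auto
qed

text \<open>Adjoining a new maximum \<open>b\<close> multiplies the product over \<open>S\<close> by
  \<open>1 + f b\<close>; the increase, \<open>f b\<close> times the old product, is exactly the
  summand for \<open>p = b\<close>.\<close>

lemma prod_one_plus_telescope:
  fixes f :: "'a::linorder \<Rightarrow> 'b::comm_semiring_1"
  assumes "finite S"
  shows "(\<Prod>p\<in>S. 1 + f p) = 1 + (\<Sum>p\<in>S. f p * (\<Prod>q | q \<in> S \<and> q < p. 1 + f q))"
  using assms
proof (induction S rule: finite_linorder_max_induct)
  case (insert b S)
  have "{q. q \<in> insert b S \<and> q < b} = S" using insert by auto
  moreover have "{q. q \<in> insert b S \<and> q < p} = {q. q \<in> S \<and> q < p}" if "p \<in> S" for p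
    using insert that by (auto dest: less_trans)
  moreover have "b \<notin> S" using insert by auto
  ultimately show ?case
    using insert by (simp add: algebra_simps)
qed simp

section \<open>Solutions of the self-power congruence modulo a prime\<close>

text \<open>A residue of order \<open>d\<close> is a root of \<open>x ^ d = 1\<close>, which has at
  most \<open>d\<close> roots modulo a prime; summing over \<open>d \<le> T\<close> gives
  \<open>T\<^sup>2\<close>. The extra 1 accounts for \<open>u = 0\<close>, whose \<open>ord\<close>
  is 0.\<close>

lemma card_small_ord_le:
  fixes p :: nat and T :: real
  assumes "prime p" "T \<ge> 0"
  shows "real (card {u. u < p \<and> real (ord p u) \<le> T}) \<le> 1 + T\<^sup>2"
proof -
  define m where "m = nat \<lfloor>T\<rfloor>"
  have mT: "real m \<le> T" using assms by (simp add: m_def)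
  let ?R = "\<lambda>d. {x \<in> {..<p}. [x ^ d = 1] (mod p)}"
  have "{u. u < p \<and> real (ord p u) \<le> T} \<subseteq> insert 0 (\<Union>d\<in>{1..m}. ?R d)"
  proof
    fix u assume "u \<in> {u. u < p \<and> real (ord p u) \<le> T}"
    then have u: "u < p" "real (ord p u) \<le> T" by auto
    show "u \<in> insert 0 (\<Union>d\<in>{1..m}. ?R d)"
    proof (cases "u = 0")
      case False
      then have "coprime p u" using u assms
        by (metis not_less0 prime_imp_coprime_nat nat_dvd_not_less neq0_conv)
      then have "ord p u \<ge> 1" using ord_gt_0_iff[of p u] by linarith
      moreover have "ord p u \<le> m" using u by (simp add: m_def le_nat_floor)
      ultimately show ?thesis using u ord[of u p] by auto
    qed auto
  qed
  then have "card {u. u < p \<and> real (ord p u) \<le> T} \<le> card (insert 0 (\<Union>d\<in>{1..m}. ?R d))"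
    by (rule card_mono[rotated]) auto
  also have "\<dots> \<le> Suc (card (\<Union>d\<in>{1..m}. ?R d))" by (rule card_insert_le_m1) auto
  also have "card (\<Union>d\<in>{1..m}. ?R d) \<le> (\<Sum>d\<in>{1..m}. card (?R d))"
    by (rule card_UN_le) auto
  also have "\<dots> \<le> (\<Sum>d\<in>{1..m}. m)"
  proof (rule sum_mono)
    fix d assume "d \<in> {1..m}"
    then show "card (?R d) \<le> m"
      using roots_mod_prime_bound[OF assms(1), of d 1] by force
  qed
  finally have "card {u. u < p \<and> real (ord p u) \<le> T} \<le> Suc (m * m)" by simp
  then have "real (card {u. u < p \<and> real (ord p u) \<le> T}) \<le> 1 + real m * real m"
    by (metis of_nat_le_iff of_nat_Suc of_nat_mult)
  also have "\<dots> \<le> 1 + T\<^sup>2" using mT by (simp add: power2_eq_square mult_mono)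
  finally show ?thesis .
qed

lemma card_residue_self_power_le:
  fixes p c u K :: nat
  assumes "prime p" "u < p" "u > 0"
  shows "card {a \<in> {1..K}. a mod p = u \<and> [a ^ a = c] (mod p)} \<le> K div p div ord p u + 1"
proof -
  let ?A = "{a \<in> {1..K}. a mod p = u \<and> [a ^ a = c] (mod p)}"
  have cop: "coprime p u" using assms
    by (metis not_less0 prime_imp_coprime_nat nat_dvd_not_less neq0_conv)
  \<comment> \<open>With \<open>k = a div p\<close> one has \<open>a = u + p * k\<close>, and
    Fermat's \<open>u ^ p = u\<close> modulo \<open>p\<close> reduces \<open>u ^ (p * k)\<close> to
    \<open>u ^ k\<close>.\<close>
  have red: "[u ^ (u + a div p) = c] (mod p)" if "a \<in> ?A" for a
  proof -
    have a: "a mod p = u" "[a ^ a = c] (mod p)" using that by auto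
    have "[u ^ p = u] (mod p)"
    proof -
      have "[u ^ (p - 1) = 1] (mod p)"
        using fermat_theorem[of p u] assms by (auto dest: nat_dvd_not_less)
      then have "[u * u ^ (p - 1) = u * 1] (mod p)" by (rule cong_scalar_left)
      then show ?thesis using assms(1) by (simp add: power_eq_if prime_gt_0_nat)
    qed
    then have "[(u ^ p) ^ (a div p) = u ^ (a div p)] (mod p)" by (rule cong_pow)
    then have "[u ^ u * (u ^ p) ^ (a div p) = u ^ u * u ^ (a div p)] (mod p)" by (rule cong_scalar_left)
    moreover have "u ^ u * (u ^ p) ^ (a div p) = u ^ a"
      by (simp add: power_mult [symmetric] power_add [symmetric] a(1) [symmetric])
    moreover have "[u ^ a = a ^ a] (mod p)"
      using a(1) by (intro cong_pow) (auto simp: cong_def)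
    ultimately show ?thesis using a(2) by (metis cong_sym cong_trans power_add)
  qed
  \<comment> \<open>The congruence fixes \<open>a div p\<close> modulo \<open>ord p u\<close>, so
    its quotient by the order determines it, and with the fixed remainder \<open>u\<close> it
    determines \<open>a\<close>.\<close>
  have "inj_on (\<lambda>a. a div p div ord p u) ?A"
  proof (rule inj_onI)
    fix a b assume a: "a \<in> ?A" and b: "b \<in> ?A" and eq: "a div p div ord p u = b div p div ord p u"
    have "[u ^ (u + a div p) = u ^ (u + b div p)] (mod p)"
      using red[OF a] red[OF b] by (metis cong_sym cong_trans)
    then have "[a div p = b div p] (mod (ord p u))"
      using order_divides_expdiff[OF cop] by (simp add: cong_add_lcancel_nat)
    then have "a div p = b div p"
      using eq unfolding cong_def by (metis div_mult_mod_eq)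
    moreover have "a mod p = b mod p" using a b by simp
    ultimately show "a = b" by (metis div_mult_mod_eq)
  qed
  then have "card ?A = card ((\<lambda>a. a div p div ord p u) ` ?A)" by (simp add: card_image)
  also have "\<dots> \<le> card {0..K div p div ord p u}"
    by (rule card_mono) (auto intro!: div_le_mono)
  finally show ?thesis by simp
qed

text \<open>The trivial count, used for residues of small order. The predicate \<open>P\<close> lets
  it apply directly to a set that also carries the congruence.\<close>

lemma card_residue_le:
  fixes p u K :: nat
  shows "card {a \<in> {1..K}. a mod p = u \<and> P a} \<le> K div p + 1"
proof -
  have "inj_on (\<lambda>a. a div p) {a \<in> {1..K}. a mod p = u \<and> P a}"
    by (rule inj_onI) (metis (mono_tags, lifting) div_mult_mod_eq mem_Collect_eq)
  then have "card {a \<in> {1..K}. a mod p = u \<and> P a} =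
      card ((\<lambda>a. a div p) ` {a \<in> {1..K}. a mod p = u \<and> P a})" by (simp add: card_image)
  also have "\<dots> \<le> card {0..K div p}"
    by (rule card_mono) (auto intro!: div_le_mono)
  finally show ?thesis by simp
qed

lemma card_self_power_cong_le:
  fixes p c K :: nat
  assumes p: "prime p" and K: "p\<^sup>2 \<le> K"
  shows "real (card {a \<in> {1..K}. [a ^ a = c] (mod p)}) \<le> 6 * real K * real p powr (-1/3)"
proof -
  \<comment> \<open>This balances the two contributions: about \<open>T\<^sup>2\<close> residues of
    small order with \<open>K / p\<close> elements each, and at most \<open>p\<close> others with
    \<open>K / (p * T)\<close> each. Both are of size \<open>K / T\<close> because
    \<open>T ^ 3 = p\<close>.\<close>
  define T where "T = real p powr (1/3)"
  have p1: "p > 1" using p by (rule prime_gt_1_nat)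
  have T1: "T \<ge> 1" using p1 by (simp add: T_def ge_one_powr_ge_zero)
  have "T ^ 3 = real p" using p1 by (simp add: T_def powr_power)
  then have T3: "T * T * T = real p" by (simp add: power3_eq_cube)
  let ?A = "\<lambda>u. {a \<in> {1..K}. a mod p = u \<and> [a ^ a = c] (mod p)}"
  define B where "B = {u. u < p \<and> real (ord p u) \<le> T}"
  \<comment> \<open>The hypothesis \<open>p\<^sup>2 \<le> K\<close> enters here: it keeps the
    \<open>p\<close> rounding terms \<open>+ 1\<close>, one per residue, within
    \<open>K / p\<close>.\<close>
  have pK: "real p \<le> real K / real p"
  proof -
    have "real (p * p) \<le> real K" using K unfolding of_nat_le_iff by (simp add: power2_eq_square)
    then show ?thesis using p1 by (simp add: field_simps)
  qed
  have div: "real (K div p) \<le> real K / real p" by (rule of_nat_div_le_of_nat)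
  have "{a \<in> {1..K}. [a ^ a = c] (mod p)} = (\<Union>u\<in>{..<p}. ?A u)"
    using p1 by auto
  then have "card {a \<in> {1..K}. [a ^ a = c] (mod p)} \<le> (\<Sum>u<p. card (?A u))"
    by (simp only:) (rule card_UN_le, simp)
  then have "real (card {a \<in> {1..K}. [a ^ a = c] (mod p)}) \<le> real (\<Sum>u<p. card (?A u))"
    by (simp only: of_nat_le_iff)
  also have "\<dots> \<le> (\<Sum>u<p. (if u \<in> B then 2 * real K / real p else 0) + (real K / real p / T + 1))"
    unfolding of_nat_sum
  proof (rule sum_mono)
    fix u assume "u \<in> {..<p}"
    then have u: "u < p" by simp
    show "real (card (?A u)) \<le> (if u \<in> B then 2 * real K / real p else 0) + (real K / real p / T + 1)"
    proof (cases "u \<in> B")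
      case True
      have "card (?A u) \<le> K div p + 1" by (rule card_residue_le)
      then have "real (card (?A u)) \<le> real K / real p + 1" using div by linarith
      moreover have "0 \<le> real K / real p / T" "0 \<le> real K / real p" using T1 by simp_all
      moreover have "2 * real K / real p = real K / real p + real K / real p" by simp
      ultimately show ?thesis using True by (simp only: if_True)
    next
      case False
      then have o: "T < real (ord p u)" using u by (auto simp: B_def)
      have "u > 0"
        using o T1 p1 by (cases "u = 0") auto
      then have "card (?A u) \<le> K div p div ord p u + 1"
        using card_residue_self_power_le[OF p u] by blast
      then have "real (card (?A u)) \<le> real (K div p div ord p u) + 1" by linarith
      also have "real (K div p div ord p u) \<le> real (K div p) / real (ord p u)"
        by (rule of_nat_div_le_of_nat)
      also have "\<dots> \<le> (real K / real p) / T"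
        using o T1 div by (intro frac_le) auto
      finally show ?thesis using False by simp
    qed
  qed
  also have "\<dots> = real (card B) * (2 * real K / real p) + real p * (real K / real p / T + 1)"
  proof -
    have "{..<p} \<inter> B = B" by (auto simp: B_def)
    then show ?thesis by (simp add: sum.distrib sum.If_cases)
  qed
  also have "\<dots> \<le> (1 + T\<^sup>2) * (2 * real K / real p) + real p * (real K / real p / T + 1)"
    using card_small_ord_le[OF p, of T] T1
    by (intro add_right_mono mult_right_mono) (auto simp: B_def)
  also have "\<dots> = 2 * real K / real p + 2 * real K / T + real K / T + real p"
    using T1 p1 by (simp add: T3 [symmetric] field_simps power2_eq_square)
  \<comment> \<open>Since \<open>T \<le> p\<close>, both \<open>K / p\<close> and, through
    \<open>pK\<close>, the term \<open>p\<close> are at most \<open>K / T\<close>. The coefficients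
    add up to 6.\<close>
  also have "\<dots> \<le> 2 * real K / T + 2 * real K / T + real K / T + real K / T"
  proof -
    have "1 * T \<le> T * T * T" using T1 by (intro mult_right_mono) (auto simp: mult_ge1_I)
    then have "real K / real p \<le> real K / T" using T1 T3 by (intro divide_left_mono) auto
    then show ?thesis using pK by simp
  qed
  also have "\<dots> = 6 * real K * real p powr (-1/3)"
    by (simp add: T_def powr_minus field_simps)
  finally show ?thesis .
qed

section \<open>Splitting the product over prime divisors\<close>

lemma sum_inverse_large_prime_divisors_le:
  fixes N K :: nat
  assumes "K \<ge> 2" "N > 0" "N \<le> K ^ K"
  shows "(\<Sum>p | p \<in> prime_factors N \<and> K < p. 1 / real p) \<le> 1"
proof -
  define P where "P = {p. p \<in> prime_factors N \<and> K < p}"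
  have "K ^ card P \<le> N"
    by (rule power_card_primes_le) (use assms in \<open>auto simp: P_def\<close>)
  then have "K ^ card P \<le> K ^ K" using assms by linarith
  then have card: "card P \<le> K" using assms by (simp add: power_increasing_iff)
  have "(\<Sum>p\<in>P. 1 / real p) \<le> (\<Sum>p\<in>P. 1 / real K)"
    by (rule sum_mono) (use assms in \<open>auto simp: P_def intro!: divide_left_mono\<close>)
  also have "\<dots> \<le> 1" using card assms by (simp add: field_simps)
  finally show ?thesis by (simp add: P_def)
qed

text \<open>The primes between the square root of \<open>K\<close> and \<open>K\<close> contribute
  at most \<open>exp (8 * \<kappa>)\<close>, those above \<open>K\<close> at most
  \<open>exp \<kappa>\<close>. The small primes remain as a sum of divisibility indicators, a form
  that can be averaged over pairs by exchanging sums; the exponent is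
  \<open>-5/6 = -1 + 1/6\<close>.\<close>

lemma prod_prime_factors_le:
  fixes N K :: nat and \<kappa> A :: real
  assumes K: "K \<ge> 2" and N: "N \<le> K ^ K" and \<kappa>: "\<kappa> > 0"
    and A: "\<And>n. n \<ge> 1 \<Longrightarrow> (\<Prod>q | prime q \<and> q < n. 1 + \<kappa> / real q) \<le> A * real n powr (1/6)"
  shows "(\<Prod>p\<in>prime_factors N. 1 + \<kappa> / real p) \<le> exp (9 * \<kappa>) *
    (1 + (\<Sum>p | prime p \<and> p\<^sup>2 \<le> K. \<kappa> * A * real p powr (-5/6) * of_bool (p dvd N)))"
\<comment> \<open>\<open>prime_factors 0\<close> is empty, so the product is 1 and it suffices that
  the right side is at least 1. Nonnegativity of \<open>A\<close> comes from the empty product at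
  \<open>n = 1\<close>.\<close>
proof (cases "N = 0")
  case True
  have "A \<ge> 0"
  proof -
    have "{q::nat. prime q \<and> q < 1} = {}" by auto
    then have "(\<Prod>q | prime q \<and> q < (1::nat). 1 + \<kappa> / real q) = 1" by (simp only: prod.empty)
    then show ?thesis using A[of 1] by simp
  qed
  then have "(0::real) \<le> (\<Sum>p | prime p \<and> p\<^sup>2 \<le> K. \<kappa> * A * real p powr (-5/6) * of_bool (p dvd N))"
    using \<kappa> by (intro sum_nonneg) auto
  moreover have "1 \<le> exp (9 * \<kappa>)" using \<kappa> by simp
  ultimately have "1 * 1 \<le> exp (9 * \<kappa>) *
    (1 + (\<Sum>p | prime p \<and> p\<^sup>2 \<le> K. \<kappa> * A * real p powr (-5/6) * of_bool (p dvd N)))"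
    by (intro mult_mono) auto
  then show ?thesis using True by simp
next
  case False
  let ?f = "\<lambda>p::nat. 1 + \<kappa> / real p"
  have f1: "1 \<le> ?f p" for p using \<kappa> by simp
  then have f0: "0 \<le> ?f p" for p by (rule order_trans[OF zero_le_one])
  define D where "D = prime_factors N"
  define D1 where "D1 = {p \<in> D. p\<^sup>2 \<le> K}"
  define D2 where "D2 = {p \<in> D. K < p\<^sup>2 \<and> p \<le> K}"
  define D3 where "D3 = {p \<in> D. K < p}"
  have fin: "finite D1" "finite D2" "finite D3" by (auto simp: D1_def D2_def D3_def D_def)
  have sq: "p \<le> p\<^sup>2" for p :: nat by (simp add: power2_eq_square)
  have split: "D = D1 \<union> (D2 \<union> D3)" "D1 \<inter> (D2 \<union> D3) = {}" "D2 \<inter> D3 = {}"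
    using order_trans[OF sq] by (fastforce simp: D1_def D2_def D3_def not_le)+
  have finK: "finite {p. prime p \<and> p\<^sup>2 \<le> K}"
    by (rule finite_subset[of _ "{..K}"]) (use sq in \<open>auto intro: order_trans\<close>)
  have fac: "prod ?f D = prod ?f D1 * (prod ?f D2 * prod ?f D3)"
    unfolding split(1) using fin split(2,3) by (simp add: prod.union_disjoint)
  have "prod ?f D2 \<le> exp (\<Sum>p\<in>D2. \<kappa> / real p)"
    by (rule prod_one_plus_le_exp) (use \<kappa> in auto)
  also have "(\<Sum>p\<in>D2. \<kappa> / real p) = \<kappa> * (\<Sum>p\<in>D2. 1 / real p)" by (simp add: sum_distrib_left)
  also have "(\<Sum>p\<in>D2. 1 / real p) \<le> (\<Sum>p | prime p \<and> K < p\<^sup>2 \<and> p \<le> K. 1 / real p)"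
    by (rule sum_mono2) (auto simp: D2_def D_def intro: finite_subset[of _ "{..K}"])
  also have "\<dots> \<le> 8" by (rule sum_inverse_primes_sqrt_le) (use K in simp)
  finally have P2: "prod ?f D2 \<le> exp (\<kappa> * 8)" using \<kappa> by simp
  have "prod ?f D3 \<le> exp (\<Sum>p\<in>D3. \<kappa> / real p)"
    by (rule prod_one_plus_le_exp) (use \<kappa> in auto)
  also have "(\<Sum>p\<in>D3. \<kappa> / real p) = \<kappa> * (\<Sum>p\<in>D3. 1 / real p)" by (simp add: sum_distrib_left)
  also have "(\<Sum>p\<in>D3. 1 / real p) \<le> 1"
    using sum_inverse_large_prime_divisors_le[OF K _ N] False by (simp add: D3_def D_def)
  finally have P3: "prod ?f D3 \<le> exp (\<kappa> * 1)" using \<kappa> by simp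
  have "prod ?f D1 = 1 + (\<Sum>p\<in>D1. \<kappa> / real p * (\<Prod>q | q \<in> D1 \<and> q < p. ?f q))"
    using fin(1) by (rule prod_one_plus_telescope)
  also have "\<dots> \<le> 1 + (\<Sum>p\<in>D1. \<kappa> * A * real p powr (-5/6))"
  proof (intro add_left_mono sum_mono)
    fix p assume "p \<in> D1"
    then have p: "p \<ge> 1" by (auto simp: D1_def D_def dest!: in_prime_factors_imp_prime prime_gt_0_nat)
    \<comment> \<open>All factors are at least 1, so the product may be enlarged to all primes below
      \<open>p\<close>, which removes its dependence on \<open>N\<close>.\<close>
    have "(\<Prod>q | q \<in> D1 \<and> q < p. ?f q) \<le> (\<Prod>q | prime q \<and> q < p. ?f q)"
      by (rule prod_mono2) (use \<kappa> f0 in \<open>auto simp: D1_def D_def\<close>)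
    also have "\<dots> \<le> A * real p powr (1/6)" by (rule A[OF p])
    finally have "\<kappa> / real p * (\<Prod>q | q \<in> D1 \<and> q < p. ?f q) \<le> \<kappa> / real p * (A * real p powr (1/6))"
      using \<kappa> by (intro mult_left_mono) auto
    also have "\<dots> = \<kappa> * A * (real p powr (-1) * real p powr (1/6))"
      using p by (simp add: powr_minus_divide)
    also have "real p powr (-1) * real p powr (1/6) = real p powr (-5/6)"
      by (subst powr_add [symmetric]) simp
    finally show "\<kappa> / real p * (\<Prod>q | q \<in> D1 \<and> q < p. ?f q) \<le> \<kappa> * A * real p powr (-5/6)" .
  qed
  also have "(\<Sum>p\<in>D1. \<kappa> * A * real p powr (-5/6)) =
      (\<Sum>p | prime p \<and> p\<^sup>2 \<le> K. \<kappa> * A * real p powr (-5/6) * of_bool (p dvd N))"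
    by (rule sum.mono_neutral_cong_left[OF finK])
       (use False in \<open>auto simp: D1_def D_def prime_factors_dvd\<close>)
  finally have P1: "prod ?f D1 \<le>
    1 + (\<Sum>p | prime p \<and> p\<^sup>2 \<le> K. \<kappa> * A * real p powr (-5/6) * of_bool (p dvd N))" .
  have "prod ?f D1 * (prod ?f D2 * prod ?f D3) \<le>
    (1 + (\<Sum>p | prime p \<and> p\<^sup>2 \<le> K. \<kappa> * A * real p powr (-5/6) * of_bool (p dvd N))) *
      (exp (\<kappa> * 8) * exp (\<kappa> * 1))"
  proof (rule mult_mono[OF P1 mult_mono[OF P2 P3]])
    show "0 \<le> 1 + (\<Sum>p | prime p \<and> p\<^sup>2 \<le> K. \<kappa> * A * real p powr (-5/6) * of_bool (p dvd N))"
      using P1 by (rule order_trans[rotated]) (intro prod_nonneg f0)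
  qed (auto intro!: prod_nonneg mult_nonneg_nonneg f0)
  also have "exp (\<kappa> * 8) * exp (\<kappa> * 1) = exp (9 * \<kappa>)" by (simp flip: exp_add)
  finally show ?thesis using fac by (simp add: D_def mult.commute)
qed

section \<open>Passing from integers to natural numbers\<close>

text \<open>The map \<open>int\<close> is a bijection from the prime factors of the absolute value
  onto those of \<open>n\<close>. For \<open>n = 0\<close> both products are empty.\<close>

lemma prod_prime_factors_int:
  fixes n :: int and f :: "real \<Rightarrow> real"
  shows "(\<Prod>p\<in>prime_factors n. f (real_of_int p)) = (\<Prod>p\<in>prime_factors (nat \<bar>n\<bar>). f (real p))"
proof (cases "n = 0")
  case False
  have "bij_betw int (prime_factors (nat \<bar>n\<bar>)) (prime_factors n)"
  proof (rule bij_betwI[where g = nat])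
    show "int \<in> prime_factors (nat \<bar>n\<bar>) \<rightarrow> prime_factors n"
      using False by (simp add: prime_factors_dvd)
    show "nat \<in> prime_factors n \<rightarrow> prime_factors (nat \<bar>n\<bar>)"
    proof
      fix p assume "p \<in> prime_factors n"
      then have p: "prime p" "p dvd n" using False by (simp_all add: prime_factors_dvd)
      then have "prime (nat p)" using prime_int_nat_transfer by blast
      moreover have "int (nat p) = p" using p prime_ge_0_int by simp
      ultimately show "nat p \<in> prime_factors (nat \<bar>n\<bar>)"
        using False p by (simp add: prime_factors_dvd dvd_nat_abs_iff)
    qed
  qed (auto simp: prime_factors_dvd dest: prime_ge_0_int)
  from prod.reindex_bij_betw[OF this, of "\<lambda>p. f (real_of_int p)"] show ?thesis by simp
qed auto

lemma abs_self_power_diff_le: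
  fixes a b K :: nat
  assumes "a \<in> {1..K}" "b \<in> {1..K}"
  shows "nat \<bar>int a ^ a - int b ^ b\<bar> \<le> K ^ K"
proof -
  have *: "int c ^ c \<le> int (K ^ K)" if "c \<in> {1..K}" for c
  proof -
    have "c ^ c \<le> K ^ c" using that by (intro power_mono) auto
    also have "\<dots> \<le> K ^ K" using that by (intro power_increasing) auto
    finally show ?thesis by (metis of_nat_le_iff of_nat_power)
  qed
  have "0 \<le> int a ^ a" "0 \<le> int b ^ b" by simp_all
  then have "\<bar>int a ^ a - int b ^ b\<bar> \<le> int (K ^ K)"
    using *[OF assms(1)] *[OF assms(2)] by linarith
  then show ?thesis by (simp add: nat_le_iff)
qed

lemma dvd_self_power_diff_iff:
  fixes a b p :: nat
  shows "p dvd nat \<bar>int a ^ a - int b ^ b\<bar> \<longleftrightarrow> [a ^ a = b ^ b] (mod p)"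
proof -
  have "[a ^ a = b ^ b] (mod p) \<longleftrightarrow> [int a ^ a = int b ^ b] (mod int p)"
    by (metis cong_int_iff of_nat_power)
  then show ?thesis by (simp add: cong_iff_dvd_diff flip: int_dvd_int_iff)
qed

section \<open>Averaging over pairs\<close>

theorem proposition3p1:
  fixes \<kappa> :: real
  assumes "\<kappa> > 0"
  shows "\<exists>C::real. C > 0 \<and> (\<forall>K::nat. K \<ge> 2 \<longrightarrow>
    1 / (real K * (real K - 1)) *
      (\<Sum>(a, b) \<in> {(a, b). a \<in> {1..K} \<and> b \<in> {1..K} \<and> a \<noteq> b}.
        \<Prod>p \<in> prime_factors (int a ^ a - int b ^ b). (1 + \<kappa> / real_of_int p)) \<le> C)"
proof -
  obtain A where A: "A > 0"
    "\<And>n. n \<ge> 1 \<Longrightarrow> (\<Prod>q | prime q \<and> q < n. 1 + \<kappa> / real q) \<le> A * real n powr (1/6)"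
    using prod_primes_below_le_powr[OF assms] by blast
  \<comment> \<open>The exponent is \<open>-5/6 - 1/3\<close>: the weight of a prime times the
    proportion of \<open>a\<close> satisfying the congruence. Convergence makes the bound
    independent of \<open>K\<close>.\<close>
  define Z where "Z = (\<Sum>n. real n powr (-7/6))"
  have summ: "summable (\<lambda>n. real n powr (-7/6))" by (simp add: summable_real_powr_iff)
  have Z0: "Z \<ge> 0" unfolding Z_def by (rule suminf_nonneg[OF summ]) simp
  define M where "M = exp (9 * \<kappa>) * (1 + 6 * \<kappa> * A * Z)"
  have M0: "M > 0" unfolding M_def using assms A Z0
    by (intro mult_pos_pos add_pos_nonneg mult_nonneg_nonneg) auto
  have "1 / (real K * (real K - 1)) *
      (\<Sum>(a, b) \<in> {(a, b). a \<in> {1..K} \<and> b \<in> {1..K} \<and> a \<noteq> b}.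
        \<Prod>p \<in> prime_factors (int a ^ a - int b ^ b). (1 + \<kappa> / real_of_int p)) \<le> 2 * M"
    if K: "K \<ge> 2" for K :: nat
  proof -
    define Q where "Q = {p. prime p \<and> p\<^sup>2 \<le> K}"
    have "p \<le> p\<^sup>2" for p :: nat by (simp add: power2_eq_square)
    then have finQ: "finite Q"
      by (intro finite_subset[of Q "{..K}"]) (auto simp: Q_def intro: order_trans)
    define g where "g = (\<lambda>p::nat. \<kappa> * A * real p powr (-5/6))"
    have g0: "0 \<le> g p" for p using assms A by (simp add: g_def)
    \<comment> \<open>A majorant of the product, defined on the diagonal as well and nonnegative, so
      that the pairs \<open>a = b\<close> can be added to the sum.\<close>
    define h where "h = (\<lambda>a b. exp (9 * \<kappa>) * (1 + (\<Sum>p\<in>Q. g p * of_bool ([a ^ a = b ^ b] (mod p)))))"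
    have h0: "0 \<le> h a b" for a b
      unfolding h_def by (intro mult_nonneg_nonneg add_nonneg_nonneg sum_nonneg g0) auto
    have count: "(\<Sum>a\<in>{1..K}. g p * of_bool ([a ^ a = c] (mod p))) \<le> 6 * \<kappa> * A * real K * real p powr (-7/6)"
      if "p \<in> Q" for p c
    proof -
      have "(\<Sum>a\<in>{1..K}. g p * of_bool ([a ^ a = c] (mod p))) =
          g p * real (card {a \<in> {1..K}. [a ^ a = c] (mod p)})"
        by (simp add: sum_of_bool_eq Int_def flip: sum_distrib_left)
      also have "\<dots> \<le> g p * (6 * real K * real p powr (-1/3))"
        using that by (intro mult_left_mono g0 card_self_power_cong_le) (auto simp: Q_def)
      also have "\<dots> = 6 * \<kappa> * A * real K * (real p powr (-5/6) * real p powr (-1/3))"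
        by (simp add: g_def)
      also have "real p powr (-5/6) * real p powr (-1/3) = real p powr (-7/6)"
        by (simp flip: powr_add)
      finally show ?thesis .
    qed
    \<comment> \<open>For fixed \<open>b\<close> the value \<open>c = b ^ b\<close> is constant, so
      after exchanging sums \<open>count\<close> applies to each prime, uniformly in
      \<open>b\<close>.\<close>
    have inner: "(\<Sum>a\<in>{1..K}. h a b) \<le> real K * M" for b
    proof -
      have "(\<Sum>a\<in>{1..K}. h a b) = exp (9 * \<kappa>) *
          (real K + (\<Sum>p\<in>Q. \<Sum>a\<in>{1..K}. g p * of_bool ([a ^ a = b ^ b] (mod p))))"
        unfolding h_def by (simp add: sum.distrib sum.swap[of _ Q] flip: sum_distrib_left)
      also have "\<dots> \<le> exp (9 * \<kappa>) * (real K + (\<Sum>p\<in>Q. 6 * \<kappa> * A * real K * real p powr (-7/6)))"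
        by (intro mult_left_mono add_left_mono sum_mono count) auto
      also have "(\<Sum>p\<in>Q. 6 * \<kappa> * A * real K * real p powr (-7/6)) =
          6 * \<kappa> * A * real K * (\<Sum>p\<in>Q. real p powr (-7/6))"
        by (simp add: sum_distrib_left)
      also have "exp (9 * \<kappa>) * (real K + \<dots>) \<le> exp (9 * \<kappa>) * (real K + 6 * \<kappa> * A * real K * Z)"
      proof (intro mult_left_mono add_left_mono)
        show "(\<Sum>p\<in>Q. real p powr (-7/6)) \<le> Z"
          unfolding Z_def by (rule sum_le_suminf[OF summ finQ]) auto
      qed (use assms A in auto)
      also have "\<dots> = real K * M" by (simp add: M_def algebra_simps)
      finally show ?thesis .
    qed
    have "(\<Sum>(a, b) \<in> {(a, b). a \<in> {1..K} \<and> b \<in> {1..K} \<and> a \<noteq> b}.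
        \<Prod>p \<in> prime_factors (int a ^ a - int b ^ b). (1 + \<kappa> / real_of_int p)) \<le>
        (\<Sum>(a, b) \<in> {(a, b). a \<in> {1..K} \<and> b \<in> {1..K} \<and> a \<noteq> b}. h a b)"
    proof (rule sum_mono, clarify)
      fix a b assume "a \<in> {1..K}" "b \<in> {1..K}"
      then have "nat \<bar>int a ^ a - int b ^ b\<bar> \<le> K ^ K" by (rule abs_self_power_diff_le)
      from prod_prime_factors_le[OF K this assms A(2)]
      show "(\<Prod>p \<in> prime_factors (int a ^ a - int b ^ b). (1 + \<kappa> / real_of_int p)) \<le> h a b"
        unfolding prod_prime_factors_int[where f = "\<lambda>x. 1 + \<kappa> / x"]
        by (simp only: dvd_self_power_diff_iff h_def g_def Q_def)
    qed
    also have "\<dots> \<le> (\<Sum>(a, b) \<in> {1..K} \<times> {1..K}. h a b)"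
      by (rule sum_mono2) (use h0 in auto)
    also have "\<dots> = (\<Sum>b\<in>{1..K}. \<Sum>a\<in>{1..K}. h a b)"
      by (subst sum.swap) (simp add: sum.cartesian_product)
    also have "\<dots> \<le> (\<Sum>b\<in>{1..K}. real K * M)" by (intro sum_mono inner)
    also have "\<dots> = real K * (real K * M)" by simp
    also have "\<dots> \<le> real K * (real K - 1) * (2 * M)"
    proof -
      \<comment> \<open>The factor 2 in the final constant pays for normalising by
        \<open>K * (K - 1)\<close> instead of \<open>K\<^sup>2\<close>; \<open>K \<ge> 2\<close>
        gives \<open>K \<le> 2 * (K - 1)\<close>.\<close>
      have "real K * M \<le> (2 * (real K - 1)) * M" using K M0 by (intro mult_right_mono) auto
      from mult_left_mono[OF this, of "real K"] show ?thesis by (simp add: algebra_simps)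
    qed
    finally show ?thesis using K by (simp add: field_simps)
  qed
  then show ?thesis using M0 by (intro exI[of _ "2 * M"]) auto
qed

end
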